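(* For every positive integer $k$ and every finite simple graph $G$, either $G$ contains no induced path on $k$ vertices, or $G$ contains an avoidable induced path on $k$ vertices.
   Context: Graphs are finite, simple and loopless. An induced path on $k$ vertices is called a $P_k$. Given an induced path $P$ in $G$, an extension of $P$ is an induced path $xPy$ in $G$, i.e. an induced path obtained from $P$ by adding a vertex $x$ adjacent to one endpoint of $P$ and a vertex $y$ adjacent to the other endpoint (the whole being an induced path). An induced path $P$ is failing if no induced cycle of $G$ contains $P$. A path $P$ in $G$ is avoidable if it is induced and has no failing extension (i.e. every extension of $P$ is contained in some induced cycle of $G$). *)

theory Defs
  imports "Graph_Theory.Graph_Theory"
begin

text \<open>
  A finite simple graph is an instance of the locale \<open>graph\<close>, i.e. a finite, loop-free, symmetric
  digraph without parallel arcs. A path is given by the list of its vertices, a cycle by the list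
  of its vertices without repeating the first one at the end.
\<close>

definition vwalk_edges :: "'a list \<Rightarrow> 'a set set" where
  "vwalk_edges p = (\<lambda>(u, v). {u, v}) ` set (vwalk_arcs p)"

definition cycle_edges :: "'a list \<Rightarrow> 'a set set" where
  "cycle_edges c = vwalk_edges (c @ [hd c])"

definition induced_path :: "('a, 'b) pre_digraph \<Rightarrow> 'a list \<Rightarrow> bool" where
  "induced_path G p \<longleftrightarrow>
     vpath p G \<and> (\<forall>u \<in> set p. \<forall>v \<in> set p. u \<rightarrow>\<^bsub>G\<^esub> v \<longrightarrow> {u, v} \<in> vwalk_edges p)"

text \<open>The length bound excludes \<open>u, v, u\<close>, which is a closed walk in a symmetric digraph.\<close>

definition induced_cycle :: "('a, 'b) pre_digraph \<Rightarrow> 'a list \<Rightarrow> bool" where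
  "induced_cycle G c \<longleftrightarrow>
     3 \<le> length c \<and> distinct c \<and> vwalk (c @ [hd c]) G \<and>
     (\<forall>u \<in> set c. \<forall>v \<in> set c. u \<rightarrow>\<^bsub>G\<^esub> v \<longrightarrow> {u, v} \<in> cycle_edges c)"

definition cycle_contains_path :: "'a list \<Rightarrow> 'a list \<Rightarrow> bool" where
  "cycle_contains_path c p \<longleftrightarrow> set p \<subseteq> set c \<and> vwalk_edges p \<subseteq> cycle_edges c"

text \<open>
  For a one-vertex path both endpoints coincide. Swapping the roles of the endpoints only reverses
  the list, so the extensions of a path and of its reversal are the same up to reversal.
\<close>

definition path_extension :: "('a, 'b) pre_digraph \<Rightarrow> 'a list \<Rightarrow> 'a list \<Rightarrow> bool" where
  "path_extension G p q \<longleftrightarrow> (\<exists>x y. q = x # p @ [y] \<and> induced_path G q)"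

definition failing :: "('a, 'b) pre_digraph \<Rightarrow> 'a list \<Rightarrow> bool" where
  "failing G p \<longleftrightarrow>
     induced_path G p \<and> \<not> (\<exists>c. induced_cycle G c \<and> cycle_contains_path c p)"

definition avoidable :: "('a, 'b) pre_digraph \<Rightarrow> 'a list \<Rightarrow> bool" where
  "avoidable G p \<longleftrightarrow> induced_path G p \<and> \<not> (\<exists>q. path_extension G p q \<and> failing G q)"

end

theory Submission
  imports Defs
begin

text \<open>
  Induct on the number of vertices. Among the connected (possibly empty) vertex sets \<open>U\<close> such that
  some \<open>P\<^sub>k\<close> lies outside the closed neighbourhood of \<open>U\<close>, choose one that is maximal, and let \<open>H\<close> be
  the graph induced by the vertices outside that neighbourhood. If \<open>U\<close> is nonempty, then \<open>H\<close> is
  smaller than \<open>G\<close> and has an avoidable \<open>P\<^sub>k\<close>, say \<open>Q\<close>; if \<open>U\<close> is empty, let \<open>Q\<close> be any \<open>P\<^sub>k\<close>. Consider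
  an extension \<open>xQy\<close> in \<open>G\<close>. If \<open>x\<close> could be added to the connected set \<open>U\<close> while \<open>y\<close> is in \<open>H\<close>, then
  \<open>Qy\<close> without its first vertex would be a \<open>P\<^sub>k\<close> outside the neighbourhood of \<open>U \<union> {x}\<close>, contradicting
  maximality. Hence \<open>x\<close> and \<open>y\<close> are both in \<open>H\<close>, where \<open>xQy\<close> lies in an induced cycle, or both have
  neighbours in \<open>U\<close>, and an induced path from \<open>y\<close> to \<open>x\<close> through \<open>U\<close> closes an induced cycle.
\<close>

section \<open>Undirected edges of vertex lists\<close>

lemma vwalk_edges_simps [simp]:
  "vwalk_edges [] = {}"
  "vwalk_edges [x] = {}"
  "vwalk_edges (x # y # p) = insert {x, y} (vwalk_edges (y # p))"
  by (simp_all add: vwalk_edges_def)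

lemma vwalk_edges_append:
  "p \<noteq> [] \<Longrightarrow> q \<noteq> [] \<Longrightarrow>
    vwalk_edges (p @ q) = insert {last p, hd q} (vwalk_edges p \<union> vwalk_edges q)"
  by (auto simp: vwalk_edges_def vwalk_arcs_append)

lemma vwalk_edges_Cons: "p \<noteq> [] \<Longrightarrow> vwalk_edges (x # p) = insert {x, hd p} (vwalk_edges p)"
  by (cases p) auto

lemma vwalk_edges_subset_vertices: "e \<in> vwalk_edges p \<Longrightarrow> e \<subseteq> set p"
  by (induction p rule: vwalk_arcs.induct) auto

lemma vwalk_edges_doubleton_vertices:
  assumes "{u, v} \<in> vwalk_edges p"
  shows "u \<in> set p" "v \<in> set p"
  using vwalk_edges_subset_vertices[OF assms] by auto

lemma (in sym_digraph) dominates_sym: "u \<rightarrow>\<^bsub>G\<^esub> v \<longleftrightarrow> v \<rightarrow>\<^bsub>G\<^esub> u"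
  using sym_arcs arcs_ends_symmetric by metis

lemma (in sym_digraph) vwalk_arcs_subset_iff_edges:
  "set (vwalk_arcs p) \<subseteq> arcs_ends G \<longleftrightarrow> (\<forall>u v. {u, v} \<in> vwalk_edges p \<longrightarrow> u \<rightarrow>\<^bsub>G\<^esub> v)"
proof (induction p rule: vwalk_arcs.induct)
  case (3 x y p)
  then show ?case
    using dominates_sym[of x y] by (auto simp: doubleton_eq_iff)
qed auto

text \<open>By symmetry, being a walk says exactly that every edge of \<open>p\<close> is an
  adjacency. Joined with inducedness, this becomes one equivalence that treats \<open>u\<close> and
  \<open>v\<close> alike.\<close>

lemma (in sym_digraph) induced_path_iff_edges:
  "induced_path G p \<longleftrightarrow> p \<noteq> [] \<and> distinct p \<and> set p \<subseteq> verts G \<and>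
     (\<forall>u \<in> set p. \<forall>v \<in> set p. u \<rightarrow>\<^bsub>G\<^esub> v \<longleftrightarrow> {u, v} \<in> vwalk_edges p)"
  unfolding induced_path_def vpath_def vwalk_def vwalk_arcs_subset_iff_edges
  using vwalk_edges_doubleton_vertices[of _ _ p] by blast

lemma (in sym_digraph) induced_cycle_iff_edges:
  "induced_cycle G c \<longleftrightarrow> 3 \<le> length c \<and> distinct c \<and> set c \<subseteq> verts G \<and>
     (\<forall>u \<in> set c. \<forall>v \<in> set c. u \<rightarrow>\<^bsub>G\<^esub> v \<longleftrightarrow> {u, v} \<in> cycle_edges c)"
proof (cases "c = []")
  case False
  then have "set (c @ [hd c]) = set c" by auto
  then show ?thesis
    unfolding induced_cycle_def vwalk_def vwalk_arcs_subset_iff_edges cycle_edges_def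
    using vwalk_edges_doubleton_vertices[of _ _ "c @ [hd c]"] by blast
qed (simp add: induced_cycle_def)

section \<open>Cutting, growing and closing induced paths\<close>

context graph
begin

text \<open>Every edge of \<open>p @ q\<close> that is not an edge of \<open>p\<close> has an end in
  \<open>q\<close>, and \<open>distinct\<close> keeps that end outside \<open>p\<close>.\<close>

lemma induced_path_prefix:
  assumes "induced_path G (p @ q)" "p \<noteq> []"
  shows "induced_path G p"
proof (cases "q = []")
  case False
  have "{u, v} \<in> vwalk_edges (p @ q) \<longleftrightarrow> {u, v} \<in> vwalk_edges p"
    if "u \<in> set p" "v \<in> set p" for u v
  proof -
    have "u \<notin> set q" "v \<notin> set q" "hd q \<in> set q"
      using assms(1) that False by (auto simp: induced_path_iff_edges)
    then show ?thesis
      using vwalk_edges_doubleton_vertices[of u v q] assms(2) False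
      by (auto simp: vwalk_edges_append doubleton_eq_iff)
  qed
  then show ?thesis
    using assms by (auto simp: induced_path_iff_edges)
qed (use assms in simp)

lemma induced_path_suffix:
  assumes "induced_path G (p @ q)" "q \<noteq> []"
  shows "induced_path G q"
proof (cases "p = []")
  case False
  have "{u, v} \<in> vwalk_edges (p @ q) \<longleftrightarrow> {u, v} \<in> vwalk_edges q"
    if "u \<in> set q" "v \<in> set q" for u v
  proof -
    have "u \<notin> set p" "v \<notin> set p" "last p \<in> set p"
      using assms(1) that False by (auto simp: induced_path_iff_edges)
    then show ?thesis
      using vwalk_edges_doubleton_vertices[of u v p] assms(2) False
      by (auto simp: vwalk_edges_append doubleton_eq_iff)
  qed
  then show ?thesis
    using assms by (auto simp: induced_path_iff_edges)
qed (use assms in simp)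

lemma induced_path_Cons_dominates_iff:
  assumes "induced_path G (x # p)" "v \<in> set p"
  shows "x \<rightarrow>\<^bsub>G\<^esub> v \<longleftrightarrow> v = hd p"
proof -
  have "x \<rightarrow>\<^bsub>G\<^esub> v \<longleftrightarrow> {x, v} \<in> vwalk_edges (x # p)" "x \<notin> set p" "p \<noteq> []"
    using assms by (auto simp: induced_path_iff_edges)
  then show ?thesis
    using vwalk_edges_doubleton_vertices[of x v p]
    by (auto simp: vwalk_edges_Cons doubleton_eq_iff)
qed

lemma induced_path_snoc_dominates_iff:
  assumes "induced_path G (p @ [y])" "v \<in> set p"
  shows "v \<rightarrow>\<^bsub>G\<^esub> y \<longleftrightarrow> v = last p"
proof -
  have "v \<rightarrow>\<^bsub>G\<^esub> y \<longleftrightarrow> {v, y} \<in> vwalk_edges (p @ [y])" "y \<notin> set p" "p \<noteq> []"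
    using assms by (auto simp: induced_path_iff_edges)
  then show ?thesis
    using vwalk_edges_doubleton_vertices[of v y p]
    by (auto simp: vwalk_edges_append doubleton_eq_iff)
qed

lemma not_dominates_self: "\<not> u \<rightarrow>\<^bsub>G\<^esub> u"
  using adj_not_same by blast

lemma induced_path_singleton: "v \<in> verts G \<Longrightarrow> induced_path G [v]"
  by (auto simp: induced_path_iff_edges not_dominates_self)

lemma induced_path_snocI:
  assumes p: "induced_path G p" and y: "y \<in> verts G" "y \<notin> set p"
    and adj: "\<And>v. v \<in> set p \<Longrightarrow> v \<rightarrow>\<^bsub>G\<^esub> y \<longleftrightarrow> v = last p"
  shows "induced_path G (p @ [y])"
proof -
  have ne: "p \<noteq> []" using p by (simp add: induced_path_iff_edges)
  have "u \<rightarrow>\<^bsub>G\<^esub> v \<longleftrightarrow> {u, v} \<in> vwalk_edges (p @ [y])"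
    if "u \<in> insert y (set p)" "v \<in> insert y (set p)" for u v
  proof -
    have "u \<rightarrow>\<^bsub>G\<^esub> v \<longleftrightarrow> {u, v} \<in> vwalk_edges p" if "u \<in> set p" "v \<in> set p"
      using p that by (simp add: induced_path_iff_edges)
    moreover have "last p \<in> set p" using ne by simp
    ultimately show ?thesis
      using that y(2) adj[of u] adj[of v] dominates_sym[of u v] not_dominates_self[of y]
        vwalk_edges_doubleton_vertices[of u v p]
      by (auto simp: vwalk_edges_append[OF ne] doubleton_eq_iff)
  qed
  then show ?thesis
    using p y by (simp add: induced_path_iff_edges)
qed

text \<open>Follows the walk step by step, keeping an induced path in \<open>W\<close> from
  \<open>a\<close> to the current vertex.\<close>

lemma reachable_within_imp_induced_path:
  assumes "(\<lambda>u v. u \<rightarrow>\<^bsub>G\<^esub> v \<and> u \<in> W \<and> v \<in> W)\<^sup>*\<^sup>* a b" "a \<in> W" "W \<subseteq> verts G"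
  shows "\<exists>p. induced_path G p \<and> set p \<subseteq> W \<and> hd p = a \<and> last p = b"
  using assms(1)
proof (induction rule: rtranclp_induct)
  case base
  then show ?case
    using assms induced_path_singleton[of a] by (intro exI[of _ "[a]"]) auto
next
  case (step b c)
  then obtain p where p: "induced_path G p" "set p \<subseteq> W" "hd p = a" "last p = b" by blast
  then have "p \<noteq> []" by (auto simp: induced_path_iff_edges)
  then have "\<exists>v \<in> set p. v = c \<or> v \<rightarrow>\<^bsub>G\<^esub> c"
    using p(4) step.hyps(2) last_in_set by blast
  \<comment> \<open>Cutting \<open>p\<close> at its first vertex that is or sees \<open>c\<close> keeps the path induced.\<close>
  from split_list_first_prop[OF this] obtain p1 v p2 where split: "p = p1 @ v # p2" "v = c \<or> v \<rightarrow>\<^bsub>G\<^esub> c"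
      "\<forall>u \<in> set p1. \<not> (u = c \<or> u \<rightarrow>\<^bsub>G\<^esub> c)"
    by blast
  have ind: "induced_path G (p1 @ [v])"
    using induced_path_prefix[of "p1 @ [v]" p2] p(1) split(1) by simp
  have sub: "set (p1 @ [v]) \<subseteq> W" and hd: "hd (p1 @ [v]) = a"
    using p split(1) by (auto simp: hd_append)
  show ?case
  proof (cases "v = c")
    case True
    then show ?thesis using ind sub hd by (intro exI[of _ "p1 @ [v]"]) auto
  next
    case False
    have "induced_path G ((p1 @ [v]) @ [c])"
    proof (rule induced_path_snocI[OF ind])
      show "c \<in> verts G" using step.hyps(2) assms(3) by auto
      show "c \<notin> set (p1 @ [v])" using split(3) False by auto
      show "u \<rightarrow>\<^bsub>G\<^esub> c \<longleftrightarrow> u = last (p1 @ [v])" if "u \<in> set (p1 @ [v])" for u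
        using that split(2,3) False by auto
    qed
    then show ?thesis
      using sub hd step.hyps(2) by (intro exI[of _ "(p1 @ [v]) @ [c]"]) (auto simp: hd_append)
  qed
qed

text \<open>Two vertices of the cycle either lie on a common path, whose inducedness decides their
  adjacency, or one is in \<open>p\<close> and the other in \<open>r\<close>, where
  \<open>nonadj\<close> rules out an edge.\<close>

lemma induced_cycle_of_two_paths:
  assumes q: "induced_path G (x # p @ [y])" and r: "induced_path G (y # r @ [x])"
    and p: "p \<noteq> []"
    and disj: "set p \<inter> set r = {}"
    and nonadj: "\<And>u v. u \<in> set p \<Longrightarrow> v \<in> set r \<Longrightarrow> \<not> u \<rightarrow>\<^bsub>G\<^esub> v"
  shows "induced_cycle G (x # p @ y # r)"
    and "cycle_contains_path (x # p @ y # r) (x # p @ [y])"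
proof -
  let ?c = "x # p @ y # r"
  have "vwalk_edges ((x # p @ [y]) @ (r @ [x])) =
      vwalk_edges (x # p @ [y]) \<union> vwalk_edges (y # r @ [x])"
    by (subst vwalk_edges_append) (auto simp: vwalk_edges_Cons)
  then have edges: "cycle_edges ?c = vwalk_edges (x # p @ [y]) \<union> vwalk_edges (y # r @ [x])"
    by (simp add: cycle_edges_def)
  then show "cycle_contains_path ?c (x # p @ [y])"
    by (auto simp: cycle_contains_path_def)
  have "u \<rightarrow>\<^bsub>G\<^esub> v \<longleftrightarrow> {u, v} \<in> cycle_edges ?c" if uv: "u \<in> set ?c" "v \<in> set ?c" for u v
  proof -
    let ?A = "set (x # p @ [y])" and ?B = "set (y # r @ [x])"
    have A: "u \<rightarrow>\<^bsub>G\<^esub> v \<longleftrightarrow> {u, v} \<in> vwalk_edges (x # p @ [y])" if "u \<in> ?A" "v \<in> ?A"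
      using q that unfolding induced_path_iff_edges by blast
    have B: "u \<rightarrow>\<^bsub>G\<^esub> v \<longleftrightarrow> {u, v} \<in> vwalk_edges (y # r @ [x])" if "u \<in> ?B" "v \<in> ?B"
      using r that unfolding induced_path_iff_edges by blast
    have "\<not> u \<rightarrow>\<^bsub>G\<^esub> v" if "\<not> (u \<in> ?A \<and> v \<in> ?A)" "\<not> (u \<in> ?B \<and> v \<in> ?B)"
      using that uv nonadj[of u v] nonadj[of v u] dominates_sym[of u v] by auto
    then show ?thesis
      unfolding edges Un_iff
      using A B vwalk_edges_doubleton_vertices[of u v "x # p @ [y]"]
        vwalk_edges_doubleton_vertices[of u v "y # r @ [x]"] by blast
  qed
  moreover have "distinct ?c" "set ?c \<subseteq> verts G"
    using q r disj by (auto simp: induced_path_iff_edges)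
  moreover have "3 \<le> length ?c" using p by (cases p) auto
  ultimately show "induced_cycle G ?c" by (simp only: induced_cycle_iff_edges) blast
qed

section \<open>Passing to induced subgraphs\<close>

lemma dominates_induce_subgraph_iff:
  "u \<rightarrow>\<^bsub>G \<restriction> S\<^esub> v \<longleftrightarrow> u \<in> S \<and> v \<in> S \<and> u \<rightarrow>\<^bsub>G\<^esub> v"
  by (auto simp: arcs_ends_conv)

lemma graph_induce_subgraph:
  assumes "S \<subseteq> verts G"
  shows "graph (G \<restriction> S)"
proof -
  interpret H: wf_digraph "G \<restriction> S" by (rule wellformed_induce_subgraph)
  show ?thesis
  proof
    show "finite (verts (G \<restriction> S))" using assms finite_verts by (auto intro: finite_subset)
    show "finite (arcs (G \<restriction> S))" by simp
    show "tail (G \<restriction> S) e \<noteq> head (G \<restriction> S) e" if "e \<in> arcs (G \<restriction> S)" for e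
      using that no_loops by simp
    show "e = e'" if "e \<in> arcs (G \<restriction> S)" "e' \<in> arcs (G \<restriction> S)"
      "arc_to_ends (G \<restriction> S) e = arc_to_ends (G \<restriction> S) e'" for e e'
      using that no_multi_arcs by (auto simp: arc_to_ends_def)
    show "symmetric (G \<restriction> S)"
      using dominates_sym dominates_induce_subgraph_iff
      by (auto simp: symmetric_def intro!: symI)
  qed
qed

lemma induced_path_induce_subgraph_iff:
  assumes "S \<subseteq> verts G"
  shows "induced_path (G \<restriction> S) p \<longleftrightarrow> induced_path G p \<and> set p \<subseteq> S"
proof -
  interpret H: graph "G \<restriction> S" using assms by (rule graph_induce_subgraph)
  show ?thesis
    unfolding induced_path_iff_edges H.induced_path_iff_edges dominates_induce_subgraph_iff
    using assms by (auto simp: subset_iff)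
qed

lemma induced_cycle_induce_subgraph_iff:
  assumes "S \<subseteq> verts G"
  shows "induced_cycle (G \<restriction> S) c \<longleftrightarrow> induced_cycle G c \<and> set c \<subseteq> S"
proof -
  interpret H: graph "G \<restriction> S" using assms by (rule graph_induce_subgraph)
  show ?thesis
    unfolding induced_cycle_iff_edges H.induced_cycle_iff_edges dominates_induce_subgraph_iff
    using assms by (auto simp: subset_iff)
qed

end

section \<open>Connected sets and their neighbourhoods\<close>

text \<open>The empty set counts as connected, so that the maximal choice in the main induction has
  a starting point.\<close>

definition connected_on :: "('a, 'b) pre_digraph \<Rightarrow> 'a set \<Rightarrow> bool" where
  "connected_on G U \<longleftrightarrow>
     (\<forall>a \<in> U. \<forall>b \<in> U. (\<lambda>u v. u \<rightarrow>\<^bsub>G\<^esub> v \<and> u \<in> U \<and> v \<in> U)\<^sup>*\<^sup>* a b)"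

text \<open>The complement of the closed neighbourhood; for empty \<open>U\<close> it is all of
  \<open>verts G\<close>.\<close>

definition non_neighbours :: "('a, 'b) pre_digraph \<Rightarrow> 'a set \<Rightarrow> 'a set" where
  "non_neighbours G U = {v \<in> verts G. v \<notin> U \<and> (\<forall>u \<in> U. \<not> u \<rightarrow>\<^bsub>G\<^esub> v)}"

lemma non_neighbours_insert_iff:
  "v \<in> non_neighbours G (insert x U) \<longleftrightarrow> v \<in> non_neighbours G U \<and> v \<noteq> x \<and> \<not> x \<rightarrow>\<^bsub>G\<^esub> v"
  by (auto simp: non_neighbours_def)

context graph
begin

lemma reachable_within_sym:
  "(\<lambda>u v. u \<rightarrow>\<^bsub>G\<^esub> v \<and> u \<in> U \<and> v \<in> U)\<^sup>*\<^sup>* a b \<Longrightarrow>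
   (\<lambda>u v. u \<rightarrow>\<^bsub>G\<^esub> v \<and> u \<in> U \<and> v \<in> U)\<^sup>*\<^sup>* b a"
  by (rule sympD[OF symp_rtranclp]) (auto intro!: sympI simp: dominates_sym)

lemma reachable_within_mono:
  assumes "(\<lambda>u v. u \<rightarrow>\<^bsub>G\<^esub> v \<and> u \<in> U \<and> v \<in> U)\<^sup>*\<^sup>* a b" "U \<subseteq> W"
  shows "(\<lambda>u v. u \<rightarrow>\<^bsub>G\<^esub> v \<and> u \<in> W \<and> v \<in> W)\<^sup>*\<^sup>* a b"
  using assms(1) by (rule rtranclp_mono[THEN predicate2D, rotated]) (use assms(2) in auto)

lemma connected_on_insert:
  assumes U: "connected_on G U" and x: "U = {} \<or> (\<exists>u \<in> U. u \<rightarrow>\<^bsub>G\<^esub> x)"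
  shows "connected_on G (insert x U)"
proof (cases "U = {}")
  case False
  let ?R = "\<lambda>u v. u \<rightarrow>\<^bsub>G\<^esub> v \<and> u \<in> insert x U \<and> v \<in> insert x U"
  obtain w where w: "w \<in> U" "w \<rightarrow>\<^bsub>G\<^esub> x" using x False by blast
  have to_w: "?R\<^sup>*\<^sup>* a w" if "a \<in> insert x U" for a
  proof (cases "a = x")
    case True
    then have "?R a w" using w dominates_sym by auto
    then show ?thesis by (rule r_into_rtranclp)
  next
    case False
    then show ?thesis
      using U w(1) that unfolding connected_on_def
      by (intro reachable_within_mono[of U a w "insert x U", OF _ subset_insertI]) auto
  qed
  show ?thesis
    unfolding connected_on_def
  proof (intro ballI)
    fix a b
    assume "a \<in> insert x U" "b \<in> insert x U"
    then show "?R\<^sup>*\<^sup>* a b"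
      using rtranclp_trans[OF to_w reachable_within_sym[OF to_w]] by blast
  qed
qed (simp add: connected_on_def)

text \<open>Adding \<open>x\<close> and \<open>y\<close> to \<open>U\<close> keeps it connected. An
  induced path from \<open>y\<close> to \<open>x\<close> in the enlarged set meets these two
  vertices only at its ends, so its interior lies in \<open>U\<close>.\<close>

lemma induced_path_through_connected_set:
  assumes U: "connected_on G U" "U \<subseteq> verts G"
    and x: "x \<in> verts G" "a \<in> U" "a \<rightarrow>\<^bsub>G\<^esub> x" and y: "y \<in> verts G" "b \<in> U" "b \<rightarrow>\<^bsub>G\<^esub> y"
    and xy: "x \<noteq> y"
  shows "\<exists>r. set r \<subseteq> U \<and> induced_path G (y # r @ [x])"
proof -
  let ?W = "insert y (insert x U)"
  let ?R = "\<lambda>u v. u \<rightarrow>\<^bsub>G\<^esub> v \<and> u \<in> ?W \<and> v \<in> ?W"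
  have "connected_on G ?W"
    using U x y by (intro connected_on_insert) auto
  then have "?R\<^sup>*\<^sup>* y x" by (simp add: connected_on_def)
  then obtain p where p: "induced_path G p" "set p \<subseteq> ?W" "hd p = y" "last p = x"
    using reachable_within_imp_induced_path[of ?W y x] U x y by auto
  then obtain p' where "p = y # p'" by (cases p) (auto simp: induced_path_iff_edges)
  with p xy obtain r where r: "p = y # r @ [x]"
    by (cases p' rule: rev_cases) auto
  then have "set r \<subseteq> U" using p(1,2) by (auto simp: induced_path_iff_edges)
  then show ?thesis using p(1) r by blast
qed

end

section \<open>The induction on the number of vertices\<close>

lemma avoidable_path_exists:
  assumes "graph G" "induced_path G p"
  shows "\<exists>q. avoidable G q \<and> length q = length p"
  using assms
proof (induction "card (verts G)" arbitrary: G p rule: less_induct)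
  case less
  then interpret graph G by simp
  define good where "good U \<longleftrightarrow> U \<subseteq> verts G \<and> connected_on G U \<and>
    (\<exists>q. induced_path G q \<and> length q = length p \<and> set q \<subseteq> non_neighbours G U)" for U
  have "good {}"
    using less.prems(2) unfolding good_def
    by (auto simp: connected_on_def non_neighbours_def induced_path_iff_edges)
  moreover have "card U \<le> card (verts G)" if "good U" for U
    using that by (auto simp: good_def intro: card_mono)
  ultimately have "\<exists>U. good U \<and> (\<forall>U'. good U' \<longrightarrow> card U' \<le> card U)"
    by (intro ex_has_greatest_nat[where b = "Suc (card (verts G))"]) (auto simp: less_Suc_eq_le)
  then obtain U where U: "good U" and max: "\<And>U'. good U' \<Longrightarrow> card U' \<le> card U"
    by blast
  let ?S = "non_neighbours G U"
  have US: "U \<subseteq> verts G" "connected_on G U" "?S \<subseteq> verts G" "finite U"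
    using U finite_verts by (auto simp: good_def non_neighbours_def intro: finite_subset)
  have not_good_insert: "\<not> good (insert x U)" if "x \<notin> U" for x
    using max[of "insert x U"] US(4) that by auto
  \<comment> \<open>For empty \<open>U\<close> the subgraph on \<open>?S\<close> is no smaller than
    \<open>G\<close>, so the induction hypothesis is out of reach and any path is taken.
    \<open>Une\<close> below shows that an extension of it cannot exist in that case.\<close>
  have "\<exists>q. induced_path G q \<and> length q = length p \<and> set q \<subseteq> ?S \<and>
      (U \<noteq> {} \<longrightarrow> avoidable (G \<restriction> ?S) q)"
  proof (cases "U = {}")
    case False
    then have "card (verts (G \<restriction> ?S)) < card (verts G)"
      using US by (auto intro!: psubset_card_mono simp: non_neighbours_def)
    moreover obtain q where "induced_path (G \<restriction> ?S) q" "length q = length p"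
      using U induced_path_induce_subgraph_iff[OF US(3)] by (auto simp: good_def)
    ultimately obtain q' where q': "avoidable (G \<restriction> ?S) q'" "length q' = length p"
      using less.hyps graph_induce_subgraph[OF US(3)] by metis
    then show ?thesis
      using induced_path_induce_subgraph_iff[OF US(3)] unfolding avoidable_def by blast
  qed (use U in \<open>auto simp: good_def\<close>)
  then obtain Q where Q: "induced_path G Q" "length Q = length p" "set Q \<subseteq> ?S"
      "U \<noteq> {} \<Longrightarrow> avoidable (G \<restriction> ?S) Q"
    by blast
  have Qne: "Q \<noteq> []" using Q(1) by (simp add: induced_path_iff_edges)
  have "\<exists>c. induced_cycle G c \<and> cycle_contains_path c (x # Q @ [y])"
    if ext: "induced_path G (x # Q @ [y])" for x y
  proof -
    have vs: "x \<in> verts G" "y \<in> verts G" "x \<noteq> y" "x \<notin> set Q" "y \<notin> set Q"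
      using ext by (auto simp: induced_path_iff_edges)
    have x_adj: "x \<rightarrow>\<^bsub>G\<^esub> v \<longleftrightarrow> v = hd Q" if "v \<in> set (Q @ [y])" for v
      using induced_path_Cons_dominates_iff[OF ext] that Qne by simp
    have y_adj: "v \<rightarrow>\<^bsub>G\<^esub> y \<longleftrightarrow> v = last Q" if "v \<in> set (x # Q)" for v
      using induced_path_snoc_dominates_iff[of "x # Q" y v] ext that Qne by simp
    \<comment> \<open>\<open>x\<close> and \<open>y\<close> see the ends of \<open>Q\<close>, which
      have no neighbour in \<open>U\<close>.\<close>
    have notU: "x \<notin> U" "y \<notin> U"
      using x_adj[of "hd Q"] y_adj[of "last Q"] Qne Q(3) dominates_sym[of "last Q" y]
      by (auto simp: non_neighbours_def subset_iff)
    have distQ: "distinct Q" using Q(1) by (simp add: induced_path_iff_edges)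
    \<comment> \<open>Dropping \<open>x\<close> and \<open>hd Q\<close> from the extension and
      keeping \<open>y\<close> leaves a path as long as \<open>Q\<close>. Since \<open>hd Q\<close>
      is the only neighbour of \<open>x\<close> there, the rest avoids the closed neighbourhood of
      \<open>insert x U\<close>, against the maximality of \<open>U\<close>.\<close>
    have y_not: "y \<notin> ?S" if x: "U = {} \<or> (\<exists>u \<in> U. u \<rightarrow>\<^bsub>G\<^esub> x)"
    proof
      assume "y \<in> ?S"
      have "[x, hd Q] @ (tl Q @ [y]) = x # Q @ [y]" using Qne by (cases Q) auto
      with ext have "induced_path G ([x, hd Q] @ (tl Q @ [y]))" by (simp only:)
      then have "induced_path G (tl Q @ [y])" by (rule induced_path_suffix) simp
      moreover have "set (tl Q @ [y]) \<subseteq> set (Q @ [y]) - {hd Q}"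
        using distQ vs(5) Qne by (cases Q) auto
      then have "v \<in> non_neighbours G (insert x U)" if "v \<in> set (tl Q @ [y])" for v
        using that Q(3) \<open>y \<in> ?S\<close> vs x_adj[of v]
        unfolding non_neighbours_insert_iff by auto
      then have "set (tl Q @ [y]) \<subseteq> non_neighbours G (insert x U)" by blast
      moreover have "length (tl Q @ [y]) = length p" using Q(2)[symmetric] Qne by simp
      ultimately have "good (insert x U)"
        using US connected_on_insert[OF US(2) x] vs(1) unfolding good_def by blast
      then show False using not_good_insert notU by blast
    qed
    \<comment> \<open>The mirror image: \<open>y\<close> and \<open>last Q\<close> are dropped, and
      \<open>y\<close> joins \<open>U\<close>.\<close>
    have x_not: "x \<notin> ?S" if y: "U = {} \<or> (\<exists>u \<in> U. u \<rightarrow>\<^bsub>G\<^esub> y)"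
    proof
      assume "x \<in> ?S"
      have "(x # butlast Q) @ [last Q, y] = x # Q @ [y]"
        using Qne by (cases Q rule: rev_cases) auto
      with ext have "induced_path G ((x # butlast Q) @ [last Q, y])" by (simp only:)
      then have "induced_path G (x # butlast Q)" by (rule induced_path_prefix) simp
      moreover have "set (x # butlast Q) \<subseteq> set (x # Q) - {last Q}"
        using distQ vs(4) Qne by (cases Q rule: rev_cases) auto
      then have "v \<in> non_neighbours G (insert y U)" if "v \<in> set (x # butlast Q)" for v
        using that Q(3) \<open>x \<in> ?S\<close> vs y_adj[of v] dominates_sym[of y v]
        unfolding non_neighbours_insert_iff by auto
      then have "set (x # butlast Q) \<subseteq> non_neighbours G (insert y U)" by blast
      moreover have "length (x # butlast Q) = length p" using Q(2)[symmetric] Qne by simp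
      ultimately have "good (insert y U)"
        using US connected_on_insert[OF US(2) y] vs(2) unfolding good_def by blast
      then show False using not_good_insert notU by blast
    qed
    \<comment> \<open>For empty \<open>U\<close>, \<open>y_not\<close> would put \<open>y\<close>
      outside \<open>verts G\<close>.\<close>
    have Une: "U \<noteq> {}" using y_not vs by (auto simp: non_neighbours_def)
    have S_or_adj: "v \<in> ?S \<or> (\<exists>u \<in> U. u \<rightarrow>\<^bsub>G\<^esub> v)" if "v \<in> verts G" "v \<notin> U" for v
      using that by (auto simp: non_neighbours_def)
    show ?thesis
    proof (cases "x \<in> ?S")
      case True
      \<comment> \<open>A neighbour of \<open>y\<close> in \<open>U\<close> would exclude
        \<open>x\<close> from \<open>?S\<close> by \<open>x_not\<close>.\<close>
      then have "y \<in> ?S" using x_not S_or_adj vs notU by blast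
      then have "induced_path (G \<restriction> ?S) (x # Q @ [y])"
        using True ext Q(3) by (simp add: induced_path_induce_subgraph_iff[OF US(3)])
      then obtain c where "induced_cycle (G \<restriction> ?S) c" "cycle_contains_path c (x # Q @ [y])"
        using Q(4)[OF Une] unfolding avoidable_def path_extension_def failing_def by blast
      then show ?thesis using induced_cycle_induce_subgraph_iff[OF US(3)] by blast
    next
      case False
      \<comment> \<open>Outside both \<open>U\<close> and \<open>?S\<close>, \<open>x\<close> has a
        neighbour in \<open>U\<close>; then \<open>y_not\<close> puts \<open>y\<close> in the same
        position.\<close>
      then obtain a b where ab: "a \<in> U" "a \<rightarrow>\<^bsub>G\<^esub> x" "b \<in> U" "b \<rightarrow>\<^bsub>G\<^esub> y"
        using y_not S_or_adj vs notU by blast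
      then obtain r where r: "set r \<subseteq> U" "induced_path G (y # r @ [x])"
        using induced_path_through_connected_set[of U x a y b] US vs by blast
      \<comment> \<open>\<open>r\<close> runs inside \<open>U\<close>, while \<open>Q\<close> avoids
        its closed neighbourhood.\<close>
      have "set Q \<inter> set r = {}" "\<And>u v. u \<in> set Q \<Longrightarrow> v \<in> set r \<Longrightarrow> \<not> u \<rightarrow>\<^bsub>G\<^esub> v"
        using r(1) Q(3) dominates_sym by (auto simp: non_neighbours_def subset_iff)
      then show ?thesis
        using induced_cycle_of_two_paths[OF ext r(2) Qne] by blast
    qed
  qed
  then have "avoidable G Q"
    using Q(1) unfolding avoidable_def path_extension_def failing_def by blast
  then show ?case using Q(2) by blast
qed

theorem theorem1p9:
  fixes G :: "('a, 'b) pre_digraph" and k :: nat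
  assumes "graph G" and "k > 0"
  shows "\<not> (\<exists>p. induced_path G p \<and> length p = k) \<or> (\<exists>p. avoidable G p \<and> length p = k)"
  using avoidable_path_exists[OF assms(1)] by blast

end
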